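(* Let $b$ be a positive integer, $k=2b$, and let $v=(v_1,\ldots,v_b)$ be a $b$-tuple of pairwise distinct elements of $\{1,2,\ldots,2b-1\}$. For every integer $n\ge 0$, $$F_{n,n}(v)=n!\,k^{\binom n2}\left(\sum_{\substack{0\le j\le k-1\\ j\notin v}}j-\sum_{\substack{0\le j\le k-1\\ j\in v}}j\right)^n,$$ where $j\in v$ means $j\in\{v_1,\ldots,v_b\}$.
   Context: For a digit $l\in\{0,\ldots,k-1\}$, $N_k(l,i)$ is the number of occurrences of the digit $l$ in the base-$k$ expansion of the nonnegative integer $i$. For $v=(v_1,\ldots,v_b)$ put $N_{k,v}(i)=\sum_{j=1}^bN_k(v_j,i)$, and $$f_{m,n}(v,x)=\sum_{i=0}^{k^n-1}(-1)^{N_{k,v}(i)}(x+i)^m.$$ It is known that $f_{n,n}(v,x)$ is a constant polynomial in $x$, and $F_{n,n}(v)$ denotes this constant: $F_{n,n}(v)=f_{n,n}(v,x)$. Zeroth powers equal $1$. *)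

theory Defs
  imports Complex_Main "HOL-Computational_Algebra.Polynomial"
begin

text \<open>
  Base-\<open>k\<close> expansion without leading zeros, least significant digit first; the expansion of \<open>0\<close>
  is the single digit \<open>0\<close>. For the meaningless bases \<open>k < 2\<close> the value is a dummy.
\<close>

fun base_digits :: "nat \<Rightarrow> nat \<Rightarrow> nat list" where
  "base_digits k i = (if k < 2 \<or> i < k then [i] else (i mod k) # base_digits k (i div k))"

declare base_digits.simps [simp del]

definition digit_count :: "nat \<Rightarrow> nat \<Rightarrow> nat \<Rightarrow> nat" where
  "digit_count k l i = count_list (base_digits k i) l"

text \<open>A tuple \<open>(v\<^sub>1, \<dots>, v\<^sub>b)\<close> is represented by a list of length \<open>b\<close>.\<close>

definition digits_count :: "nat \<Rightarrow> nat list \<Rightarrow> nat \<Rightarrow> nat" where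
  "digits_count k v i = (\<Sum>j<length v. digit_count k (v ! j) i)"

text \<open>
  \<open>f_poly k m n v\<close> is \<open>f\<^bsub>m,n\<^esub>(v, x)\<close> as a polynomial in \<open>x\<close> over the integers;
  \<open>[:int i, 1:]\<close> is \<open>x + i\<close>.
\<close>

definition f_poly :: "nat \<Rightarrow> nat \<Rightarrow> nat \<Rightarrow> nat list \<Rightarrow> int poly" where
  "f_poly k m n v = (\<Sum>i = 0..<k ^ n. smult ((-1) ^ digits_count k v i) ([:int i, 1:] ^ m))"

text \<open>
  \<open>F_const k n v\<close> is \<open>F\<^bsub>n,n\<^esub>(v)\<close>: the constant to which the polynomial \<open>f\<^bsub>n,n\<^esub>(v, x)\<close> is equal.
  It is unspecified where that polynomial is not constant.
\<close>

definition F_const :: "nat \<Rightarrow> nat \<Rightarrow> nat list \<Rightarrow> int" where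
  "F_const k n v = (THE c. f_poly k n n v = [:c:])"

end

theory Submission
  imports Defs
begin

text \<open>
  Write \<open>s(i) = (-1)\<^bsup>N(i)\<^esup>\<close> for the sign of \<open>i\<close>. Since \<open>0\<close> is not an entry of \<open>v\<close>, leading zeros do
  not matter, so \<open>s\<close> is multiplicative along digits: \<open>s(kq + r) = s(q) s(r)\<close> for \<open>r < k\<close>. On single
  digits \<open>s\<close> is \<open>-1\<close> exactly on the \<open>b\<close> entries of \<open>v\<close>, hence balanced: \<open>\<Sum>\<^sub>r s(r) = 0\<close>.
  Put \<open>D = \<Sum>\<^sub>r r s(r)\<close>, which is the difference of sums in the formula.

  Summing \<open>s(i) p(i)\<close> over \<open>i < k\<^bsup>n+1\<^esup>\<close> by first summing over the lowest digit \<open>r\<close> replaces \<open>p\<close>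
  by the polynomial \<open>g(y) = \<Sum>\<^sub>r s(r) p(r + ky)\<close> and leaves a sum over \<open>k\<^sup>n\<close> terms. The leading
  coefficient of \<open>p(r + ky)\<close> does not depend on \<open>r\<close>, so balance cancels it, and in the next
  coefficient only the part \<open>k\<^sup>n (n+1) r\<close> times the leading coefficient of \<open>p\<close> survives
  (\<open>coeff_pcompose_linear_subleading\<close>). So each digit lowers the degree by one and multiplies the
  leading coefficient by \<open>(n+1) k\<^sup>n D\<close>; after all \<open>n\<close> digits, \<open>n! k\<^bsup>n choose 2\<^esup> D\<^sup>n\<close> times the
  coefficient of degree \<open>n\<close> is left (\<open>sum_digit_multiplicative_poly\<close>). Applied to
  \<open>p(y) = (x + y)\<^sup>n\<close>, which is monic whatever \<open>x\<close> is, this gives constancy in \<open>x\<close> and the value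
  at once.
\<close>

lemma coeff_pcompose_linear_leading:
  fixes p :: "'a :: comm_ring_1 poly"
  assumes "degree p \<le> n"
  shows "coeff (pcompose p [:r, c:]) n = c ^ n * coeff p n"
  using assms
proof (induction n arbitrary: p)
  case 0
  then obtain a where "p = [:a:]" by (auto elim: degree_eq_zeroE)
  then show ?case by simp
next
  case (Suc n)
  obtain a q where p: "p = pCons a q" by (cases p)
  have q: "degree q \<le> n" using Suc.prems p by (auto split: if_splits)
  have "degree (pcompose q [:r, c:]) < Suc n"
    using degree_pcompose_le[of q "[:r, c:]"] q
    by (auto simp: less_Suc_eq_le split: if_splits)
  then have "coeff (pcompose q [:r, c:]) (Suc n) = 0" by (rule coeff_eq_0)
  then show ?case using Suc.IH[OF q] by (simp add: p pcompose_pCons algebra_simps)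
qed

lemma coeff_pcompose_linear_subleading:
  fixes p :: "'a :: comm_ring_1 poly"
  assumes "degree p \<le> Suc n"
  shows "coeff (pcompose p [:r, c:]) n
    = c ^ n * (coeff p n + of_nat (Suc n) * r * coeff p (Suc n))"
  using assms
proof (induction n arbitrary: p)
  case 0
  obtain a q where p: "p = pCons a q" by (cases p)
  have "degree q = 0" using 0 p by (auto split: if_splits)
  then obtain d where "q = [:d:]" by (auto elim: degree_eq_zeroE)
  then show ?case by (simp add: p pcompose_pCons algebra_simps)
next
  case (Suc n)
  obtain a q where p: "p = pCons a q" by (cases p)
  have q: "degree q \<le> Suc n" using Suc.prems p by (auto split: if_splits)
  show ?case
    using Suc.IH[OF q] coeff_pcompose_linear_leading[OF q, of r c]
    by (simp add: p pcompose_pCons algebra_simps)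
qed

text \<open>
  Multiplicativity makes the signed sum a composition of \<open>n\<close> weighted differences, one for each
  digit, the one for digit position \<open>j\<close> having step \<open>k\<^sup>j\<close>. Balance makes each of them kill constants, so
  together they see only the coefficient of degree \<open>n\<close>. The factors \<open>(j+1) k\<^sup>j D\<close> for \<open>j < n\<close>
  multiply to the stated constant.
\<close>

lemma sum_digit_multiplicative_poly:
  fixes s :: "nat \<Rightarrow> 'a :: {comm_ring_1, ring_char_0}" and p :: "'a poly"
  assumes mult: "\<And>q r. r < k \<Longrightarrow> s (q * k + r) = s q * s r"
    and one: "s 0 = 1"
    and balanced: "(\<Sum>r<k. s r) = 0"
    and deg: "degree p \<le> n"
  shows "(\<Sum>i<k ^ n. s i * poly p (of_nat i))
    = fact n * of_nat k ^ (n choose 2) * (\<Sum>r<k. of_nat r * s r) ^ n * coeff p n"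
  using deg
proof (induction n arbitrary: p)
  case 0
  then obtain a where "p = [:a:]" by (auto elim: degree_eq_zeroE)
  then show ?case using one by (simp add: numeral_2_eq_2)
next
  case (Suc n)
  define D where "D = (\<Sum>r<k. of_nat r * s r)"
  define L where "L r = pcompose p [:of_nat r, of_nat k:]" for r
  define g where "g = (\<Sum>r<k. smult (s r) (L r))"
  have coeff_L_top: "coeff (L r) (Suc n) = of_nat k ^ Suc n * coeff p (Suc n)" for r
    unfolding L_def using Suc.prems by (rule coeff_pcompose_linear_leading)
  have coeff_L_sub: "coeff (L r) n
      = of_nat k ^ n * (coeff p n + of_nat (Suc n) * of_nat r * coeff p (Suc n))" for r
    unfolding L_def using Suc.prems by (rule coeff_pcompose_linear_subleading)
  have "degree (L r) \<le> Suc n" for r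
    using degree_pcompose_le[of p "[:of_nat r, of_nat k:]"] Suc.prems
    by (auto simp: L_def split: if_splits)
  then have "degree (smult (s r) (L r)) \<le> Suc n" for r
    using degree_smult_le le_trans by blast
  then have "degree g \<le> Suc n"
    unfolding g_def by (intro degree_sum_le) auto
  moreover have "coeff g (Suc n) = 0"
  proof -
    have "coeff g (Suc n) = (\<Sum>r<k. s r) * (of_nat k ^ Suc n * coeff p (Suc n))"
      unfolding g_def by (simp only: coeff_sum coeff_smult coeff_L_top sum_distrib_right)
    then show ?thesis using balanced by simp
  qed
  ultimately have deg_g: "degree g \<le> n"
    by (metis eq_zero_or_degree_less le_SucE leading_coeff_0_iff degree_0 zero_le)
  have coeff_g: "coeff g n = of_nat (Suc n) * of_nat k ^ n * D * coeff p (Suc n)"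
  proof -
    have "coeff g n = (\<Sum>r<k. s r) * (of_nat k ^ n * coeff p n)
        + D * (of_nat (Suc n) * of_nat k ^ n * coeff p (Suc n))"
      unfolding g_def D_def sum_distrib_right coeff_sum coeff_smult coeff_L_sub
        sum.distrib[symmetric]
      by (intro sum.cong) (simp_all add: algebra_simps)
    then show ?thesis using balanced by (simp add: algebra_simps)
  qed
  have "(\<Sum>i<k ^ Suc n. s i * poly p (of_nat i))
      = (\<Sum>i<k ^ n * k. s i * poly p (of_nat i))"
    by (simp add: mult.commute)
  also have "\<dots> = (\<Sum>q<k ^ n. \<Sum>i = q * k..<q * k + k. s i * poly p (of_nat i))"
    by (rule sum.nat_group[symmetric])
  also have "\<dots> = (\<Sum>q<k ^ n. s q * poly g (of_nat q))"
  proof (rule sum.cong[OF refl])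
    fix q
    have "(\<Sum>i = q * k..<q * k + k. s i * poly p (of_nat i))
        = (\<Sum>r<k. s (q * k + r) * poly p (of_nat (q * k + r)))"
      using sum.shift_bounds_nat_ivl[of "\<lambda>i. s i * poly p (of_nat i)" 0 "q * k" k]
      by (simp add: atLeast0LessThan add.commute)
    also have "\<dots> = (\<Sum>r<k. s q * (s r * poly (L r) (of_nat q)))"
      by (intro sum.cong) (simp_all add: mult L_def poly_pcompose mult.assoc
          add.commute[of "of_nat q * of_nat k :: 'a"])
    finally show "(\<Sum>i = q * k..<q * k + k. s i * poly p (of_nat i)) = s q * poly g (of_nat q)"
      by (simp add: g_def poly_sum sum_distrib_left)
  qed
  also have "\<dots> = fact n * of_nat k ^ (n choose 2) * D ^ n * coeff g n"
    unfolding D_def using deg_g by (rule Suc.IH)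
  also have "\<dots> = fact (Suc n) * of_nat k ^ (Suc n choose 2) * D ^ Suc n * coeff p (Suc n)"
    by (simp add: coeff_g numeral_2_eq_2 power_add algebra_simps)
  finally show ?case unfolding D_def .
qed

lemma digits_count_eq_sum_set:
  assumes "distinct v"
  shows "digits_count k v i = (\<Sum>l\<in>set v. digit_count k l i)"
  using assms
  by (simp add: digits_count_def sum_list_sum_nth atLeast0LessThan
      flip: sum_list_distinct_conv_sum_set)

lemma digits_count_single_digit:
  assumes "distinct v" "i < k"
  shows "digits_count k v i = (if i \<in> set v then 1 else 0)"
proof -
  have "digit_count k l i = (if l = i then 1 else 0)" for l
    using assms(2) by (cases "l = i") (simp_all add: digit_count_def base_digits.simps)
  then show ?thesis using assms(1) by (simp add: digits_count_eq_sum_set)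
qed

text \<open>
  This fails for \<open>q = 0\<close> when the digit \<open>0\<close> is counted, since \<open>0 * k + r\<close> has no leading zero; hence
  the condition that the entries of \<open>v\<close> are positive.
\<close>

lemma digits_count_append_digit:
  assumes "distinct v" "0 \<notin> set v" "2 \<le> k" "r < k"
  shows "digits_count k v (q * k + r) = digits_count k v q + digits_count k v r"
proof (cases "q = 0")
  case True
  then show ?thesis using assms by (simp add: digits_count_single_digit)
next
  case False
  have "k \<le> q * k + r" using False by (cases q) auto
  then have "base_digits k (q * k + r) = r # base_digits k q"
    using assms by (subst base_digits.simps) simp
  moreover have "base_digits k r = [r]"
    using assms by (simp add: base_digits.simps)
  ultimately have "digit_count k l (q * k + r) = digit_count k l q + digit_count k l r" for l
    by (simp add: digit_count_def)
  then show ?thesis using assms(1) by (simp add: digits_count_eq_sum_set sum.distrib)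
qed

theorem proposition3p4:
  fixes b k n :: nat and v :: "nat list"
  assumes "b > 0"
    and "k = 2 * b"
    and "length v = b"
    and "distinct v"
    and "set v \<subseteq> {1..2 * b - 1}"
  shows "F_const k n v =
    fact n * int k ^ (n choose 2) *
      ((\<Sum>j | j \<le> k - 1 \<and> j \<notin> set v. int j) - (\<Sum>j | j \<le> k - 1 \<and> j \<in> set v. int j)) ^ n"
proof -
  define s :: "nat \<Rightarrow> int" where "s i = (-1) ^ digits_count k v i" for i
  let ?A = "{j. j \<le> k - 1 \<and> j \<notin> set v}" and ?B = "{j. j \<le> k - 1 \<and> j \<in> set v}"
  define D where "D = (\<Sum>j\<in>?A. int j) - (\<Sum>j\<in>?B. int j)"
  have k: "2 \<le> k" using assms by simp
  have zero: "0 \<notin> set v" using assms by auto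
  have s_digit: "s r = (if r \<in> set v then -1 else 1)" if "r < k" for r
    using digits_count_single_digit[OF assms(4) that] by (simp add: s_def)
  have digits: "{..<k} = ?A \<union> ?B" using k by auto
  have split: "(\<Sum>r<k. h r * s r) = sum h ?A - sum h ?B" for h
  proof -
    have "(\<Sum>r<k. h r * s r) = (\<Sum>r\<in>?A. h r * s r) + (\<Sum>r\<in>?B. h r * s r)"
      unfolding digits by (intro sum.union_disjoint) auto
    also have "(\<Sum>r\<in>?A. h r * s r) = sum h ?A"
      using k by (intro sum.cong) (auto simp: s_digit)
    also have "(\<Sum>r\<in>?B. h r * s r) = (\<Sum>r\<in>?B. - h r)"
      using k by (intro sum.cong) (auto simp: s_digit)
    finally show ?thesis by (simp add: sum_negf)
  qed
  have "?B = set v" using assms by auto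
  then have cardB: "card ?B = b" using assms distinct_card by metis
  have "card ?A + card ?B = k"
    by (subst card_Un_disjoint[symmetric]) (auto simp only: digits[symmetric] card_lessThan)
  then have "card ?A = card ?B" using cardB assms by simp
  then have balanced: "(\<Sum>r<k. s r) = 0" using split[of "\<lambda>_. 1"] by simp
  have mult: "s (q * k + r) = s q * s r" if "r < k" for q r
    using digits_count_append_digit[OF assms(4) zero k that]
    by (simp add: s_def power_add)
  have one: "s 0 = 1" using s_digit[of 0] zero k by simp
  have D: "(\<Sum>r<k. int r * s r) = D" by (simp add: split D_def)
  define C where "C = fact n * int k ^ (n choose 2) * D ^ n"
  have "poly (f_poly k n n v) x = C" for x
  proof -
    have deg: "degree ([:x, 1:] ^ n) \<le> n"
      using degree_power_le[of "[:x, 1:]" n] by simp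
    have "poly (f_poly k n n v) x = (\<Sum>i<k ^ n. s i * poly ([:x, 1:] ^ n) (int i))"
      by (simp add: f_poly_def poly_sum s_def atLeast0LessThan add.commute)
    also have "\<dots> = C"
      using sum_digit_multiplicative_poly[OF mult one balanced deg]
      by (simp add: C_def D coeff_linear_power)
    finally show ?thesis .
  qed
  then have "f_poly k n n v = [:C:]"
    by (intro poly_eq_poly_eq_iff[THEN iffD1]) (simp add: fun_eq_iff)
  then have "F_const k n v = C" by (simp add: F_const_def)
  then show ?thesis by (simp add: C_def D_def)
qed

end
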